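(* Let $\Lambda=\{\lambda_1,\lambda_2,\ldots\}$ be a countable set of distinct real numbers, let $-\infty\leq\alpha<\beta\leq\infty$, and let $f_1,f_2\in\mathcal{D}_{\Lambda}$ be two equivalent ($f_1\overset{*}{\sim}f_2$) almost periodic functions in the vertical strip $\{\sigma+it\in\mathbb{C}:\alpha<\sigma<\beta\}$. Let $E$ be an open set of real numbers included in $(\alpha,\beta)$. Then $$\bigcup_{\sigma\in E}\operatorname{Img}\left(f_1(\sigma+it)\right)=\bigcup_{\sigma\in E}\operatorname{Img}\left(f_2(\sigma+it)\right).$$ That is, $f_1$ and $f_2$ take the same set of values on the region $\{s=\sigma+it\in\mathbb{C}:\sigma\in E\}$.
   Context: Almost periodic functions. For an open vertical strip $U=\{s\in\mathbb{C}:\alpha<\operatorname{Re}s<\beta\}$ with $-\infty\le\alpha<\beta\le\infty$, $AP(U,\mathbb{C})$ is the set of functions $f:U\to\mathbb{C}$ that can be approximated uniformly on every reduced strip $\{s:\alpha_1\le\operatorname{Re}s\le\beta_1\}$, $\alpha<\alpha_1<\beta_1<\beta$, by exponential polynomials $c_1e^{\mu_1s}+\cdots+c_ne^{\mu_ns}$ with $c_j\in\mathbb{C}$, $\mu_j\in\mathbb{R}$. The Dirichlet series of $f\in AP(U,\mathbb{C})$ is the formal series $\sum_{\lambda}a(\lambda)e^{\lambda s}$, where $a(\lambda)=\lim_{T\to\infty}\frac{1}{2T}\int_{-T}^{T}f(\sigma+it)e^{-\lambda(\sigma+it)}\,dt$ (independent of $\sigma\in(\alpha,\beta)$), which is nonzero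 for at most countably many real $\lambda$; it determines $f$. The class $\mathcal{D}_\Lambda$. For a countable set $\Lambda=\{\lambda_1,\lambda_2,\ldots\}$ of distinct real numbers (finite or infinite), a function $f$ is in $\mathcal{D}_\Lambda$ if it belongs to $AP(U,\mathbb{C})$ for an open vertical strip $U$ and its Dirichlet series is of the form $\sum_{j\ge1}a_je^{\lambda_js}$ with $a_j\in\mathbb{C}$. Equivalence. Let $f_1,f_2\in\mathcal{D}_\Lambda$ have Dirichlet series $\sum_{j\ge1}a_je^{\lambda_js}$ and $\sum_{j\ge1}b_je^{\lambda_js}$. Then $f_1\overset{*}{\sim}f_2$ means: for each integer $n\ge1$ with $n\le\sharp\Lambda$ there is a $\mathbb{Q}$-linear map $\psi_n:V_n\to\mathbb{R}$, where $V_n\subset\mathbb{R}$ is the $\mathbb{Q}$-vector space generated by $\lambda_1,\ldots,\lambda_n$, such that $b_j=a_je^{i\psi_n(\lambda_j)}$ for $j=1,\ldots,n$. Notation. $\operatorname{Img}(f(\sigma_0+it))=\{w\in\mathbb{C}:\exists t\in\mathbb{R},\ w=f(\sigma_0+it)\}$. *)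

theory Defs
  imports "HOL-Analysis.Analysis"
begin

text \<open>Strip boundaries are extended reals. A function on a strip is represented by a total
  function \<open>complex \<Rightarrow> complex\<close>; every notion below only looks at its values on the strip.\<close>

definition exp_polynomial :: "(complex \<Rightarrow> complex) \<Rightarrow> bool" where
  "exp_polynomial p \<longleftrightarrow>
     (\<exists>(n::nat) (c :: nat \<Rightarrow> complex) (\<mu> :: nat \<Rightarrow> real).
        p = (\<lambda>s. \<Sum>j=1..n. c j * exp (of_real (\<mu> j) * s)))"

definition AP :: "ereal \<Rightarrow> ereal \<Rightarrow> (complex \<Rightarrow> complex) set" where
  "AP \<alpha> \<beta> = {f. \<forall>\<alpha>1 \<beta>1 :: real. \<alpha> < ereal \<alpha>1 \<and> \<alpha>1 < \<beta>1 \<and> ereal \<beta>1 < \<beta> \<longrightarrow>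
      (\<forall>\<epsilon>>0. \<exists>p. exp_polynomial p \<and>
         (\<forall>s. \<alpha>1 \<le> Re s \<and> Re s \<le> \<beta>1 \<longrightarrow> cmod (f s - p s) < \<epsilon>))}"

definition has_dirichlet_coeff ::
    "ereal \<Rightarrow> ereal \<Rightarrow> (complex \<Rightarrow> complex) \<Rightarrow> real \<Rightarrow> complex \<Rightarrow> bool" where
  "has_dirichlet_coeff \<alpha> \<beta> f l c \<longleftrightarrow>
     (\<forall>\<sigma>::real. \<alpha> < ereal \<sigma> \<and> ereal \<sigma> < \<beta> \<longrightarrow>
        ((\<lambda>T::real. of_real (1 / (2 * T)) *
             integral {-T..T} (\<lambda>t. f (Complex \<sigma> t) * exp (- of_real l * Complex \<sigma> t)))
          \<longlongrightarrow> c) at_top)"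

text \<open>The limit exists and is the same for all \<open>\<sigma>\<close> whenever \<open>f \<in> AP \<alpha> \<beta>\<close> and \<open>\<alpha> < \<beta>\<close>.\<close>

definition dirichlet_coeff ::
    "ereal \<Rightarrow> ereal \<Rightarrow> (complex \<Rightarrow> complex) \<Rightarrow> real \<Rightarrow> complex" where
  "dirichlet_coeff \<alpha> \<beta> f l = (THE c. has_dirichlet_coeff \<alpha> \<beta> f l c)"

lemma has_dirichlet_coeff_unique:
  assumes "\<alpha> < \<beta>" "has_dirichlet_coeff \<alpha> \<beta> f l c" "has_dirichlet_coeff \<alpha> \<beta> f l d"
  shows "c = d"
proof -
  obtain \<sigma> where "\<alpha> < ereal \<sigma>" "ereal \<sigma> < \<beta>"
    using ereal_dense2[OF assms(1)] by blast
  with assms(2,3) show ?thesis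
    unfolding has_dirichlet_coeff_def by (blast intro: tendsto_unique[OF trivial_limit_at_top_linorder])
qed

lemma dirichlet_coeff_eqI:
  "\<alpha> < \<beta> \<Longrightarrow> has_dirichlet_coeff \<alpha> \<beta> f l c \<Longrightarrow> dirichlet_coeff \<alpha> \<beta> f l = c"
  unfolding dirichlet_coeff_def by (blast intro: has_dirichlet_coeff_unique)

text \<open>The members of the class with exponent set \<open>\<Lambda>\<close> whose domain is the strip between \<open>\<alpha>\<close> and \<open>\<beta>\<close>.\<close>

definition D_class :: "ereal \<Rightarrow> ereal \<Rightarrow> real set \<Rightarrow> (complex \<Rightarrow> complex) set" where
  "D_class \<alpha> \<beta> \<Lambda> = {f \<in> AP \<alpha> \<beta>. \<forall>l. l \<notin> \<Lambda> \<longrightarrow> dirichlet_coeff \<alpha> \<beta> f l = 0}"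

text \<open>The positive integers not exceeding the (possibly infinite) cardinality of \<open>\<Lambda>\<close>.\<close>

definition indices :: "real set \<Rightarrow> nat set" where
  "indices \<Lambda> = {n. 1 \<le> n \<and> (finite \<Lambda> \<longrightarrow> n \<le> card \<Lambda>)}"

definition enumerates :: "(nat \<Rightarrow> real) \<Rightarrow> real set \<Rightarrow> bool" where
  "enumerates lam \<Lambda> \<longleftrightarrow> bij_betw lam (indices \<Lambda>) \<Lambda>"

abbreviation rat_scale :: "rat \<Rightarrow> real \<Rightarrow> real" where
  "rat_scale q x \<equiv> of_rat q * x"

lemma vector_space_rat_scale: "vector_space rat_scale"
  by standard (auto simp: algebra_simps of_rat_add of_rat_mult)

definition rat_span :: "real set \<Rightarrow> real set" where
  "rat_span S = module.span rat_scale S"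

definition rat_linear_on :: "real set \<Rightarrow> (real \<Rightarrow> real) \<Rightarrow> bool" where
  "rat_linear_on V \<psi> \<longleftrightarrow>
     (\<forall>x\<in>V. \<forall>y\<in>V. \<psi> (x + y) = \<psi> x + \<psi> y) \<and>
     (\<forall>q. \<forall>x\<in>V. \<psi> (rat_scale q x) = rat_scale q (\<psi> x))"

definition star_equiv ::
    "ereal \<Rightarrow> ereal \<Rightarrow> real set \<Rightarrow> (nat \<Rightarrow> real) \<Rightarrow>
     (complex \<Rightarrow> complex) \<Rightarrow> (complex \<Rightarrow> complex) \<Rightarrow> bool" where
  "star_equiv \<alpha> \<beta> \<Lambda> lam f1 f2 \<longleftrightarrow>
     (\<forall>n \<in> indices \<Lambda>. \<exists>\<psi>. rat_linear_on (rat_span (lam ` {1..n})) \<psi> \<and>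
        (\<forall>j\<in>{1..n}. dirichlet_coeff \<alpha> \<beta> f2 (lam j) =
           dirichlet_coeff \<alpha> \<beta> f1 (lam j) * exp (\<i> * of_real (\<psi> (lam j)))))"

definition Img :: "(complex \<Rightarrow> complex) \<Rightarrow> real \<Rightarrow> complex set" where
  "Img f \<sigma> = {w. \<exists>t::real. w = f (Complex \<sigma> t)}"

end

theory Submission imports Defs "HOL-Complex_Analysis.Complex_Analysis" begin

text \<open>Some vertical translate of \<open>f1\<close> is uniformly close to \<open>f2\<close> on any given reduced strip;
  since uniform limits of translates inherit values by a Hurwitz argument, and equivalence is
  symmetric, both functions then take the same values. To find the translate, let \<open>P\<close> and \<open>Q\<close> be
  exponential polynomials close to \<open>f1\<close> and \<open>f2\<close>, and let \<open>S\<close> be a finite set of reals that is almost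
  invariant under shifts by their frequencies. For an additive \<open>\<psi>\<close> realising the equivalence on
  \<open>S - S\<close>, the nonnegative weight \<open>\<bar>\<Sum>x\<in>S. cis (x * t - \<psi> x)\<bar>\<^sup>2 / card S\<close> has mean one and, integrated
  against \<open>f1 (s + \<i> * t)\<close>, gives exactly what the weight with \<open>\<psi> = 0\<close> gives for \<open>f2\<close>; the latter
  mean is close to \<open>f2 s\<close>, because this holds for \<open>Q\<close>. On \<open>P\<close> the first weight acts almost as
  multiplication of the coefficient at \<open>\<mu>\<close> by \<open>cis (\<psi> \<mu>)\<close>, and a Kronecker-type argument with the
  same weight shows that some translation does so, too.\<close>

section \<open>Means of continuous functions on the real line\<close>

text \<open>Continuity is built in so that every integral involved exists; on non-integrable
  functions \<open>integral\<close> returns the default 0, and additivity of the mean could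
  fail.\<close>

definition has_mean :: "(real \<Rightarrow> complex) \<Rightarrow> complex \<Rightarrow> bool" where
  "has_mean g m \<longleftrightarrow> continuous_on UNIV g \<and>
     ((\<lambda>T::real. of_real (1 / (2 * T)) * integral {-T..T} g) \<longlongrightarrow> m) at_top"

lemma continuous_imp_integrable_interval:
  fixes g :: "real \<Rightarrow> 'a::banach"
  shows "continuous_on UNIV g \<Longrightarrow> g integrable_on {a..b}"
  by (rule integrable_continuous_real) (rule continuous_on_subset, auto)

lemma has_mean_add:
  assumes "has_mean g m" "has_mean h n"
  shows "has_mean (\<lambda>t. g t + h t) (m + n)"
proof -
  have "integral {-T..T} (\<lambda>t. g t + h t) = integral {-T..T} g + integral {-T..T} h" for T
    using assms by (intro integral_add continuous_imp_integrable_interval) (auto simp: has_mean_def)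
  moreover have "((\<lambda>T::real. of_real (1 / (2 * T)) * integral {-T..T} g +
      of_real (1 / (2 * T)) * integral {-T..T} h) \<longlongrightarrow> m + n) at_top"
    using assms by (intro tendsto_add) (auto simp: has_mean_def)
  ultimately show ?thesis
    using assms by (auto simp: has_mean_def distrib_left intro: continuous_on_add)
qed

lemma has_mean_cmult:
  assumes "has_mean g m"
  shows "has_mean (\<lambda>t. c * g t) (c * m)"
proof -
  have "((\<lambda>T::real. c * (of_real (1 / (2 * T)) * integral {-T..T} g)) \<longlongrightarrow> c * m) at_top"
    using assms by (intro tendsto_mult_left) (auto simp: has_mean_def)
  then show ?thesis
    using assms by (auto simp: has_mean_def mult_ac intro: continuous_on_mult_left)
qed

lemma has_mean_zero: "has_mean (\<lambda>t. 0) 0"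
  by (simp add: has_mean_def)

lemma has_mean_diff:
  "has_mean g m \<Longrightarrow> has_mean h n \<Longrightarrow> has_mean (\<lambda>t. g t - h t) (m - n)"
  using has_mean_add[OF _ has_mean_cmult[of h n "-1"], of g m] by simp

lemma has_mean_sum:
  "(\<And>i. i \<in> I \<Longrightarrow> has_mean (g i) (m i)) \<Longrightarrow> has_mean (\<lambda>t. \<Sum>i\<in>I. g i t) (\<Sum>i\<in>I. m i)"
  by (induction I rule: infinite_finite_induct) (auto intro: has_mean_add has_mean_zero)

text \<open>The averages of \<open>g\<close> are at most \<open>e\<close> times those of
  \<open>K\<close>, which tend to 1. With \<open>K = 1\<close> this is the plain supremum bound;
  with \<open>K\<close> a kernel it lets uniform errors pass through weighted means.\<close>

lemma has_mean_bound:
  assumes g: "has_mean g m" and K: "has_mean (\<lambda>t. of_real (K t)) 1"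
    and le: "\<And>t. cmod (g t) \<le> e * K t"
  shows "cmod m \<le> e"
proof -
  define A where "A = (\<lambda>T::real. of_real (1 / (2 * T)) * integral {-T..T} g)"
  define B where "B = (\<lambda>T::real. of_real (1 / (2 * T)) * integral {-T..T} (\<lambda>t. complex_of_real (K t)))"
  have A: "(A \<longlongrightarrow> m) at_top" and B: "(B \<longlongrightarrow> 1) at_top"
    using g K by (auto simp: has_mean_def A_def B_def)
  have Kc: "continuous_on UNIV K"
  proof -
    have "continuous_on UNIV (\<lambda>t. Re (complex_of_real (K t)))"
      using K by (intro continuous_on_Re) (auto simp: has_mean_def)
    then show ?thesis by simp
  qed
  have "cmod (A T) \<le> e * Re (B T)" if "T > 0" for T
  proof -
    have "cmod (integral {-T..T} g) \<le> integral {-T..T} (\<lambda>t. e * K t)"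
      using g Kc le
      by (intro integral_norm_bound_integral continuous_imp_integrable_interval continuous_on_mult_left)
         (auto simp: has_mean_def)
    also have "\<dots> = e * integral {-T..T} K" by simp
    finally have "cmod (integral {-T..T} g) \<le> e * integral {-T..T} K" .
    moreover have "integral {-T..T} (\<lambda>t. complex_of_real (K t)) = of_real (integral {-T..T} K)"
      using integral_linear[OF continuous_imp_integrable_interval[OF Kc] bounded_linear_of_real, of "-T" T]
      by (simp add: o_def)
    ultimately show ?thesis using that
      by (simp add: A_def B_def norm_mult norm_divide divide_simps)
  qed
  then have "eventually (\<lambda>T. cmod (A T) \<le> e * Re (B T)) at_top"
    by (rule eventually_mono[OF eventually_gt_at_top[of 0]])
  moreover have "((\<lambda>T. cmod (A T)) \<longlongrightarrow> cmod m) at_top" using A by (rule tendsto_norm)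
  moreover have "((\<lambda>T. e * Re (B T)) \<longlongrightarrow> e * Re 1) at_top"
    using B by (intro tendsto_mult_left tendsto_Re)
  ultimately show ?thesis
    using tendsto_le[OF trivial_limit_at_top_linorder] by fastforce
qed

lemma has_mean_Re_nonneg:
  assumes g: "has_mean g m" and nn: "\<And>t. 0 \<le> Re (g t)"
  shows "0 \<le> Re m"
proof -
  have gc: "continuous_on UNIV g" using g by (simp add: has_mean_def)
  have I: "Re (integral {-T..T} g) = integral {-T..T} (\<lambda>t. Re (g t))" for T
    using integral_linear[OF continuous_imp_integrable_interval[OF gc] bounded_linear_Re, of "-T" T]
    by (simp add: o_def)
  have "0 \<le> Re (of_real (1 / (2 * T)) * integral {-T..T} g)" if "T > 0" for T
    using that nn gc I
    by (auto intro!: divide_nonneg_nonneg integral_nonneg continuous_imp_integrable_interval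
        continuous_intros)
  then have "\<forall>\<^sub>F T in at_top. 0 \<le> Re (of_real (1 / (2 * T)) * integral {-T..T} g)"
    by (rule eventually_mono[OF eventually_gt_at_top[of 0]])
  moreover have "((\<lambda>T::real. Re (of_real (1 / (2 * T)) * integral {-T..T} g)) \<longlongrightarrow> Re m) at_top"
    using g by (intro tendsto_Re) (auto simp: has_mean_def)
  ultimately show ?thesis
    by (intro tendsto_lowerbound[OF _ _ trivial_limit_at_top_linorder])
qed

lemma has_mean_one: "has_mean (\<lambda>t. 1) 1"
proof -
  have "eventually (\<lambda>T::real. 1 = complex_of_real (1 / (2 * T)) * integral {-T..T} (\<lambda>t. 1)) at_top"
    using eventually_gt_at_top[of "0::real"]
    by eventually_elim (simp add: scaleR_conv_of_real)
  from tendsto_cong[OF this] show ?thesis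
    unfolding has_mean_def by (auto simp del: integral_const)
qed

text \<open>For \<open>x \<noteq> 0\<close> the antiderivative \<open>?F\<close> is bounded, so the
  averages are \<open>O(1/T)\<close>. This orthogonality relation is the source of all explicit
  means below.\<close>

lemma has_mean_cis: "has_mean (\<lambda>t. cis (x * t)) (if x = 0 then 1 else 0)"
proof (cases "x = 0")
  case True
  then show ?thesis using has_mean_one by simp
next
  case False
  let ?F = "\<lambda>t. cis (x * t) / (\<i> * of_real x)"
  have "(?F has_vector_derivative cis (x * t)) (at t within A)" for t A
  proof -
    have "((\<lambda>z. exp (\<i> * of_real x * z) / (\<i> * of_real x)) has_field_derivative
        exp (\<i> * of_real x * of_real t)) (at (of_real t))"
      using False by (auto intro!: derivative_eq_intros)
    from has_vector_derivative_real_field[OF this] show ?thesis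
      by (simp add: cis_conv_exp mult.assoc)
  qed
  then have "((\<lambda>t. cis (x * t)) has_integral ?F T - ?F (- T)) {-T..T}" if "T > 0" for T
    using that by (intro fundamental_theorem_of_calculus) auto
  then have I: "integral {-T..T} (\<lambda>t. cis (x * t)) = ?F T - ?F (- T)" if "T > 0" for T
    using that by (blast intro: integral_unique)
  have "cmod (?F T - ?F (-T)) \<le> 1 / \<bar>x\<bar> + 1 / \<bar>x\<bar>" for T
    by (rule order_trans[OF norm_triangle_ineq4]) (simp add: norm_divide norm_mult)
  then have bd: "cmod (of_real (1 / (2 * T)) * integral {-T..T} (\<lambda>t. cis (x * t))) \<le> (1 / \<bar>x\<bar>) / T"
    if "T > 0" for T
    unfolding I[OF that] norm_mult norm_of_real
    using that mult_left_mono[of "cmod (?F T - ?F (-T))" "1 / \<bar>x\<bar> + 1 / \<bar>x\<bar>" "1 / (2 * T)"]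
    by (simp add: mult.commute)
  have "((\<lambda>T::real. (1 / \<bar>x\<bar>) / T) \<longlongrightarrow> 0) at_top"
    by (rule tendsto_divide_0[OF tendsto_const filterlim_at_top_imp_at_infinity[OF filterlim_ident]])
  then have "((\<lambda>T::real. of_real (1 / (2 * T)) * integral {-T..T} (\<lambda>t. cis (x * t))) \<longlongrightarrow> 0) at_top"
    by (rule Lim_null_comparison[rotated])
       (use bd in \<open>auto intro: eventually_mono[OF eventually_gt_at_top[of 0]]\<close>)
  then show ?thesis using False
    unfolding has_mean_def by (auto intro!: continuous_intros)
qed

text \<open>Continuity survives uniform limits, and the means of uniformly close functions are
  close. Hence the means of the approximants form a Cauchy sequence, and its limit is the mean of
  \<open>f\<close> by an \<open>e/3\<close> argument.\<close>

lemma has_mean_uniform_limit: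
  assumes "\<And>e. e > 0 \<Longrightarrow> \<exists>g m. has_mean g m \<and> (\<forall>t. cmod (f t - g t) \<le> e)"
  shows "\<exists>m. has_mean f m"
proof -
  have "\<forall>k. \<exists>g m. has_mean g m \<and> (\<forall>t. cmod (f t - g t) \<le> 1 / real (Suc k))"
    by (intro allI assms) simp
  then obtain g m where g: "\<And>k. has_mean (g k) (m k)"
    and fg: "\<And>k t. cmod (f t - g k t) \<le> 1 / real (Suc k)" by metis
  have small: "\<exists>k0. \<forall>k\<ge>k0. 1 / real (Suc k) < e" if "e > 0" for e
  proof -
    obtain k0 where k0: "1 / real (Suc k0) < e" using nat_approx_posE \<open>e > 0\<close> by blast
    have "1 / real (Suc k) \<le> 1 / real (Suc k0)" if "k \<ge> k0" for k
      using that by (simp add: frac_le)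
    with k0 show ?thesis by (meson le_less_trans)
  qed
  have cont: "continuous_on UNIV f"
  proof (rule uniform_limit_theorem)
    show "\<forall>\<^sub>F n in sequentially. continuous_on UNIV (g n)" using g by (simp add: has_mean_def)
    show "uniform_limit UNIV g f sequentially"
      unfolding uniform_limit_iff eventually_sequentially dist_norm
    proof (intro allI impI)
      fix e :: real assume "e > 0"
      from small[OF this] obtain k0 where "\<forall>k\<ge>k0. 1 / real (Suc k) < e" by blast
      then show "\<exists>N. \<forall>n\<ge>N. \<forall>x\<in>UNIV. norm (g n x - f x) < e"
        using fg by (metis le_less_trans norm_minus_commute)
    qed
  qed auto
  have mm: "cmod (m k - m l) \<le> 1 / real (Suc k) + 1 / real (Suc l)" for k l
  proof (rule has_mean_bound[OF has_mean_diff[OF g g], where K = "\<lambda>_. 1"])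
    fix t
    have "cmod (g k t - g l t) = cmod ((f t - g l t) - (f t - g k t))" by simp
    also have "\<dots> \<le> cmod (f t - g l t) + cmod (f t - g k t)" by (rule norm_triangle_ineq4)
    finally show "cmod (g k t - g l t) \<le> (1 / real (Suc k) + 1 / real (Suc l)) * 1"
      using fg[of t k] fg[of t l] by simp
  qed (use has_mean_one in simp)
  have "Cauchy m"
  proof (rule CauchyI)
    fix e :: real assume "e > 0"
    then obtain k0 where "\<forall>k\<ge>k0. 1 / real (Suc k) < e / 2" using small[of "e/2"] by auto
    then show "\<exists>M. \<forall>i\<ge>M. \<forall>n\<ge>M. norm (m i - m n) < e"
      using mm by (smt (verit) field_sum_of_halves)
  qed
  then obtain l where l: "m \<longlonglongrightarrow> l" using Cauchy_convergent convergent_def by blast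
  let ?A = "\<lambda>h T::real. complex_of_real (1 / (2 * T)) * integral {-T..T} h"
  have "(?A f \<longlongrightarrow> l) at_top"
  proof (rule tendstoI)
    fix e :: real assume "e > 0"
    then have "e / 3 > 0" by simp
    from small[OF this] obtain k0 where k0: "\<forall>k\<ge>k0. 1 / real (Suc k) < e / 3" by blast
    from l \<open>e / 3 > 0\<close> obtain k1 where k1: "\<forall>k\<ge>k1. dist (m k) l < e / 3"
      by (meson lim_sequentially)
    define k where "k = max k0 k1"
    have a: "1 / real (Suc k) < e / 3" "dist (m k) l < e / 3" using k0 k1 by (auto simp: k_def)
    have "eventually (\<lambda>T. dist (?A (g k) T) (m k) < e / 3) at_top"
      using g[of k] \<open>e / 3 > 0\<close> by (intro tendstoD) (auto simp: has_mean_def)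
    then show "eventually (\<lambda>T. dist (?A f T) l < e) at_top"
      using eventually_gt_at_top[of 0]
    proof eventually_elim
      case (elim T)
      have "?A f T - ?A (g k) T = of_real (1 / (2 * T)) * integral {-T..T} (\<lambda>t. f t - g k t)"
        using cont g[of k]
        by (subst integral_diff) (auto simp: has_mean_def right_diff_distrib
            intro: continuous_imp_integrable_interval)
      moreover have "cmod (integral {-T..T} (\<lambda>t. f t - g k t)) \<le> integral {-T..T} (\<lambda>t. 1 / real (Suc k))"
        using cont g[of k] fg
        by (intro integral_norm_bound_integral continuous_imp_integrable_interval continuous_on_diff)
           (auto simp: has_mean_def)
      ultimately have "cmod (?A f T - ?A (g k) T) \<le> 1 / real (Suc k)"
        using elim by (simp add: norm_mult norm_divide divide_simps del: of_nat_Suc)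
      then have "dist (?A f T) (?A (g k) T) < e / 3" using a by (simp add: dist_norm)
      with elim a show ?case
        using dist_triangle[of "?A f T" l "?A (g k) T"] dist_triangle[of "?A (g k) T" l "m k"]
        by linarith
    qed
  qed
  with cont show ?thesis unfolding has_mean_def by blast
qed

section \<open>Dirichlet coefficients as means along vertical lines\<close>

lemma strip_between:
  assumes "\<alpha> < ereal x" "ereal x < \<beta>" "\<alpha> < ereal y" "ereal y < \<beta>"
  obtains a b :: real where "\<alpha> < ereal a" "a < b" "ereal b < \<beta>" "a \<le> x" "a \<le> y" "x \<le> b" "y \<le> b"
proof -
  have "\<alpha> < ereal (min x y)" "ereal (max x y) < \<beta>" using assms by (auto simp: min_def max_def)
  then obtain a b where "\<alpha> < ereal a" "a < min x y" "max x y < b" "ereal b < \<beta>"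
    using ereal_dense2 by (metis less_ereal.simps(1))
  then show thesis using that[of a b] by auto
qed

lemma AP_approx:
  assumes "f \<in> AP \<alpha> \<beta>" "\<alpha> < ereal a" "a < b" "ereal b < \<beta>" "e > 0"
  obtains n c \<mu> where
    "\<And>s. a \<le> Re s \<Longrightarrow> Re s \<le> b \<Longrightarrow> cmod (f s - (\<Sum>j=1..n::nat. c j * exp (of_real (\<mu> j) * s))) < e"
  using assms unfolding AP_def exp_polynomial_def by fastforce

lemma has_mean_exp_poly:
  assumes "finite J"
  shows "has_mean (\<lambda>t. (\<Sum>j\<in>J. c j * exp (of_real (\<mu> j) * (s + \<i> * of_real t))) * cis (- \<nu> * t))
     ((\<Sum>j\<in>J. if \<mu> j = \<nu> then c j else 0) * exp (of_real \<nu> * s))"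
proof -
  have "has_mean (\<lambda>t. \<Sum>j\<in>J. (c j * exp (of_real (\<mu> j) * s)) * cis ((\<mu> j - \<nu>) * t))
     (\<Sum>j\<in>J. (c j * exp (of_real (\<mu> j) * s)) * (if \<mu> j - \<nu> = 0 then 1 else 0))"
    by (intro has_mean_sum has_mean_cmult has_mean_cis)
  moreover have "(c j * exp (of_real (\<mu> j) * s)) * cis ((\<mu> j - \<nu>) * t) =
      c j * exp (of_real (\<mu> j) * (s + \<i> * of_real t)) * cis (- \<nu> * t)" for j t
    by (simp add: cis_conv_exp exp_add[symmetric] algebra_simps flip: exp_add)
  ultimately show ?thesis
    by (auto simp: sum_distrib_right if_distrib cong: if_cong elim!: back_subst[where P = "has_mean _"]
        intro!: sum.cong)
qed

text \<open>For an exponential polynomial the mean at \<open>s\<close> is a constant times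
  \<open>exp (\<nu> * s)\<close>. An approximation valid on a reduced strip containing both
  \<open>s\<close> and \<open>s'\<close> therefore puts the two normalised means near one common
  constant, and letting the error tend to 0 makes them equal.\<close>

lemma AP_mean_exists:
  assumes f: "f \<in> AP \<alpha> \<beta>" and "\<alpha> < \<beta>"
  obtains a where "\<And>s. \<alpha> < ereal (Re s) \<Longrightarrow> ereal (Re s) < \<beta> \<Longrightarrow>
     has_mean (\<lambda>t. f (s + \<i> * of_real t) * cis (- \<nu> * t)) (a * exp (of_real \<nu> * s))"
proof -
  let ?g = "\<lambda>s t. f (s + \<i> * of_real t) * cis (- \<nu> * t)"
  let ?P = "\<lambda>n c \<mu> s. \<Sum>j=1..n::nat. c j * exp (complex_of_real (\<mu> j) * s)"
  have close: "cmod (?g s t - ?P n c \<mu> (s + \<i> * of_real t) * cis (- \<nu> * t)) \<le> e"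
    if "\<And>s. a \<le> Re s \<Longrightarrow> Re s \<le> b \<Longrightarrow> cmod (f s - ?P n c \<mu> s) < e" "a \<le> Re s" "Re s \<le> b"
    for a b n c \<mu> s e t
  proof -
    have "?g s t - ?P n c \<mu> (s + \<i> * of_real t) * cis (- \<nu> * t) =
       (f (s + \<i> * of_real t) - ?P n c \<mu> (s + \<i> * of_real t)) * cis (- \<nu> * t)"
      by (simp add: left_diff_distrib)
    with that(1)[of "s + \<i> * of_real t"] that(2,3) show ?thesis
      by (simp add: norm_mult del: mult_minus_left)
  qed
  have ex: "\<exists>m. has_mean (?g s) m" if s: "\<alpha> < ereal (Re s)" "ereal (Re s) < \<beta>" for s
  proof (rule has_mean_uniform_limit)
    fix e :: real assume "e > 0"
    obtain a b where ab: "\<alpha> < ereal a" "a < b" "ereal b < \<beta>" "a \<le> Re s" "Re s \<le> b"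
      using strip_between[OF s s] by metis
    from AP_approx[OF f ab(1-3) \<open>e > 0\<close>] obtain n c \<mu> where
      "\<And>s. a \<le> Re s \<Longrightarrow> Re s \<le> b \<Longrightarrow> cmod (f s - ?P n c \<mu> s) < e" by metis
    from close[OF this ab(4,5)] show "\<exists>h m. has_mean h m \<and> (\<forall>t. cmod (?g s t - h t) \<le> e)"
      using has_mean_exp_poly[of "{1..n}" c \<mu> s \<nu>] by blast
  qed
  define m where "m s = (SOME m. has_mean (?g s) m)" for s
  have m: "has_mean (?g s) (m s)" if "\<alpha> < ereal (Re s)" "ereal (Re s) < \<beta>" for s
    using someI_ex[OF ex[OF that]] by (simp add: m_def)
  have indep: "m s * exp (- of_real \<nu> * s) = m s' * exp (- of_real \<nu> * s')"
    if s: "\<alpha> < ereal (Re s)" "ereal (Re s) < \<beta>" and s': "\<alpha> < ereal (Re s')" "ereal (Re s') < \<beta>" for s s'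
  proof -
    define C where "C = cmod (exp (- of_real \<nu> * s)) + cmod (exp (- of_real \<nu> * s'))"
    obtain a b where ab: "\<alpha> < ereal a" "a < b" "ereal b < \<beta>" and
      in1: "a \<le> Re s" "Re s \<le> b" and in2: "a \<le> Re s'" "Re s' \<le> b"
      using strip_between[OF s s'] by metis
    have "cmod (m s * exp (- of_real \<nu> * s) - m s' * exp (- of_real \<nu> * s')) \<le> e * C" if "e > 0" for e
    proof -
      from AP_approx[OF f ab(1-3) \<open>e > 0\<close>] obtain n c \<mu> where
        P: "\<And>s. a \<le> Re s \<Longrightarrow> Re s \<le> b \<Longrightarrow> cmod (f s - ?P n c \<mu> s) < e" by metis
      \<comment> \<open>The \<open>\<mu> j\<close> may repeat, so \<open>d\<close> collects all
        terms of frequency \<open>\<nu>\<close>; it is the same for every \<open>z\<close> in the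
        reduced strip.\<close>
      define d where "d = (\<Sum>j=1..n. if \<mu> j = \<nu> then c j else 0)"
      have *: "cmod (m z * exp (- of_real \<nu> * z) - d) \<le> e * cmod (exp (- of_real \<nu> * z))"
        if z: "a \<le> Re z" "Re z \<le> b" for z
      proof -
        have "\<alpha> < ereal (Re z)" "ereal (Re z) < \<beta>"
          using z ab by (meson ereal_less_eq(3) less_le_trans le_less_trans)+
        then have "has_mean (\<lambda>t. ?g z t - ?P n c \<mu> (z + \<i> * of_real t) * cis (- \<nu> * t)) (m z - d * exp (of_real \<nu> * z))"
          unfolding d_def by (intro has_mean_diff m has_mean_exp_poly) auto
        from has_mean_bound[OF this, of "\<lambda>_. 1" e] have "cmod (m z - d * exp (of_real \<nu> * z)) \<le> e"
          using close[OF P z] has_mean_one by simp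
        moreover have "m z * exp (- of_real \<nu> * z) - d = (m z - d * exp (of_real \<nu> * z)) * exp (- of_real \<nu> * z)"
          by (simp add: left_diff_distrib mult.assoc flip: exp_add)
        ultimately show ?thesis by (simp only: norm_mult mult_right_mono norm_ge_zero)
      qed
      have "cmod (m s * exp (- of_real \<nu> * s) - m s' * exp (- of_real \<nu> * s'))
         = cmod ((m s * exp (- of_real \<nu> * s) - d) - (m s' * exp (- of_real \<nu> * s') - d))" by simp
      also have "\<dots> \<le> e * C"
        using norm_triangle_ineq4 *[OF in1] *[OF in2] unfolding C_def distrib_left
        by (meson add_mono order_trans)
      finally show ?thesis .
    qed
    moreover have "C > 0" unfolding C_def by (intro add_pos_pos) (simp_all del: norm_exp_eq_Re)
    ultimately have "cmod (m s * exp (- of_real \<nu> * s) - m s' * exp (- of_real \<nu> * s')) \<le> 0 + e" if "e > 0" for e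
      using that spec[of "\<lambda>e. e > 0 \<longrightarrow> _ \<le> e * C" "e / C"] by (metis add_0 divide_pos_pos nonzero_eq_divide_eq order_less_irrefl)
    then have "cmod (m s * exp (- of_real \<nu> * s) - m s' * exp (- of_real \<nu> * s')) \<le> 0"
      by (rule field_le_epsilon)
    then show ?thesis by simp
  qed
  obtain x where x: "\<alpha> < ereal x" "ereal x < \<beta>" using ereal_dense2[OF \<open>\<alpha> < \<beta>\<close>] by blast
  let ?x = "complex_of_real x"
  show thesis
  proof (rule that)
    fix s assume s: "\<alpha> < ereal (Re s)" "ereal (Re s) < \<beta>"
    have "m s = (m s * exp (- of_real \<nu> * s)) * exp (of_real \<nu> * s)"
      by (simp add: mult.assoc flip: exp_add)
    also have "\<dots> = (m ?x * exp (- of_real \<nu> * ?x)) * exp (of_real \<nu> * s)"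
      using indep[OF s, of ?x] x by simp
    finally show "has_mean (?g s) (m ?x * exp (- of_real \<nu> * ?x) * exp (of_real \<nu> * s))"
      using m[OF s] by simp
  qed
qed

text \<open>This identifies the constant of \<open>AP_mean_exists\<close> with the coefficient given
  by a definite description. The form with a complex base point \<open>s\<close> is what the kernel
  computations use.\<close>

lemma has_mean_dirichlet_coeff:
  assumes f: "f \<in> AP \<alpha> \<beta>" and s: "\<alpha> < ereal (Re s)" "ereal (Re s) < \<beta>"
  shows "has_mean (\<lambda>t. f (s + \<i> * of_real t) * cis (- \<nu> * t))
     (dirichlet_coeff \<alpha> \<beta> f \<nu> * exp (of_real \<nu> * s))"
proof -
  have "\<alpha> < \<beta>" using s by order
  obtain a where a: "\<And>s. \<alpha> < ereal (Re s) \<Longrightarrow> ereal (Re s) < \<beta> \<Longrightarrow>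
     has_mean (\<lambda>t. f (s + \<i> * of_real t) * cis (- \<nu> * t)) (a * exp (of_real \<nu> * s))"
    using AP_mean_exists[OF f \<open>\<alpha> < \<beta>\<close>] by metis
  have "has_dirichlet_coeff \<alpha> \<beta> f \<nu> a"
    unfolding has_dirichlet_coeff_def
  proof (intro allI impI)
    fix \<sigma> :: real assume "\<alpha> < ereal \<sigma> \<and> ereal \<sigma> < \<beta>"
    \<comment> \<open>The constant factor \<open>exp (- \<nu> * \<sigma>)\<close> turns the weight
      \<open>cis (- \<nu> * t)\<close> into the full exponential in the definition of the
      coefficient.\<close>
    then have "has_mean (\<lambda>t. exp (- of_real \<nu> * of_real \<sigma>) * (f (of_real \<sigma> + \<i> * of_real t) * cis (- \<nu> * t)))
        (exp (- of_real \<nu> * of_real \<sigma>) * (a * exp (of_real \<nu> * of_real \<sigma>)))"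
      by (intro has_mean_cmult a) auto
    moreover have "exp (- of_real \<nu> * of_real \<sigma>) * (a * exp (of_real \<nu> * of_real \<sigma>)) = a"
      by (simp add: mult.left_commute flip: exp_add)
    moreover have "exp (- of_real \<nu> * of_real \<sigma>) * (f (of_real \<sigma> + \<i> * of_real t) * cis (- \<nu> * t)) =
        f (Complex \<sigma> t) * exp (- of_real \<nu> * Complex \<sigma> t)" for t
      by (simp add: complex_eq cis_conv_exp Complex_eq distrib_left mult_ac flip: exp_add)
    ultimately have "has_mean (\<lambda>t. f (Complex \<sigma> t) * exp (- of_real \<nu> * Complex \<sigma> t)) a"
      by (simp only:)
    then show "((\<lambda>T::real. of_real (1 / (2 * T)) *
             integral {-T..T} (\<lambda>t. f (Complex \<sigma> t) * exp (- of_real \<nu> * Complex \<sigma> t)))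
          \<longlongrightarrow> a) at_top"
      by (simp only: has_mean_def)
  qed
  with a[OF s] show ?thesis using dirichlet_coeff_eqI[OF \<open>\<alpha> < \<beta>\<close>] by metis
qed

section \<open>Fejer-type weights and their means\<close>

text \<open>For \<open>S = {0, ..., N - 1}\<close> and \<open>\<psi> = 0\<close> this is the Fejer
  kernel; \<open>\<psi>\<close> inserts phases. The division by \<open>card S\<close> normalises the
  mean to 1 for finite nonempty \<open>S\<close>.\<close>

definition kernel :: "real set \<Rightarrow> (real \<Rightarrow> real) \<Rightarrow> real \<Rightarrow> real" where
  "kernel S \<psi> t = (cmod (\<Sum>x\<in>S. cis (x * t - \<psi> x)))\<^sup>2 / real (card S)"

text \<open>The fraction of \<open>S\<close> that a shift by \<open>\<mu>\<close> keeps inside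
  \<open>S\<close>. It is the Fourier coefficient of the kernel with \<open>\<psi> = 0\<close> at
  \<open>\<mu>\<close>, and values near 1 mean that \<open>S\<close> is almost invariant.\<close>

definition overlap :: "real set \<Rightarrow> real \<Rightarrow> real" where
  "overlap S \<mu> = real (card {x \<in> S. x + \<mu> \<in> S}) / real (card S)"

lemma kernel_nonneg: "0 \<le> kernel S \<psi> t"
  by (simp add: kernel_def)

lemma overlap_le_1: "finite S \<Longrightarrow> S \<noteq> {} \<Longrightarrow> overlap S \<mu> \<le> 1"
  unfolding overlap_def by (auto simp: divide_simps card_gt_0_iff intro: card_mono)

lemma of_real_kernel:
  "complex_of_real (kernel S \<psi> t) =
     (\<Sum>x\<in>S. \<Sum>y\<in>S. cis (\<psi> y - \<psi> x) * cis (- (y - x) * t)) / of_nat (card S)"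
proof -
  have "cis (x * t - \<psi> x) * cnj (cis (y * t - \<psi> y)) = cis (\<psi> y - \<psi> x) * cis (- (y - x) * t)" for x y
    by (simp add: cis_cnj cis_mult algebra_simps)
  then show ?thesis
    by (simp only: kernel_def of_real_divide complex_norm_square cnj_sum sum_product
        of_real_of_nat_eq)
qed

text \<open>Expanding the square makes the kernel a finite trigonometric sum with frequencies
  \<open>x - y\<close>. Hence the weighted mean involves only the coefficients of \<open>g\<close>
  at differences of elements of \<open>S\<close>, which are finitely many when \<open>S\<close> is
  finite.\<close>

lemma has_mean_kernel:
  assumes "\<And>\<nu>. has_mean (\<lambda>t. g t * cis (- \<nu> * t)) (c \<nu>)"
  shows "has_mean (\<lambda>t. of_real (kernel S \<psi> t) * g t)
     ((\<Sum>x\<in>S. \<Sum>y\<in>S. cis (\<psi> y - \<psi> x) * c (y - x)) / of_nat (card S))"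
proof -
  have "has_mean (\<lambda>t. (1 / of_nat (card S)) * (\<Sum>x\<in>S. \<Sum>y\<in>S. cis (\<psi> y - \<psi> x) * (g t * cis (- (y - x) * t))))
    ((1 / of_nat (card S)) * (\<Sum>x\<in>S. \<Sum>y\<in>S. cis (\<psi> y - \<psi> x) * c (y - x)))"
    by (intro has_mean_cmult has_mean_sum assms)
  then show ?thesis
    by (simp add: of_real_kernel sum_distrib_right sum_distrib_left sum_divide_distrib mult_ac)
qed

text \<open>Only pairs with \<open>y = x + \<mu>\<close> survive, and additivity gives each of them
  the same phase \<open>cis (\<psi> \<mu>)\<close>. What remains is a count of such pairs, namely
  the overlap.\<close>

lemma has_mean_kernel_cis:
  assumes "finite S" and add: "\<And>x y. \<psi> (x + y) = \<psi> x + \<psi> y"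
  shows "has_mean (\<lambda>t. of_real (kernel S \<psi> t) * cis (\<mu> * t)) (cis (\<psi> \<mu>) * of_real (overlap S \<mu>))"
proof -
  have "has_mean (\<lambda>t. cis (\<mu> * t) * cis (- \<nu> * t)) (if \<nu> = \<mu> then 1 else 0)" for \<nu>
    using has_mean_cis[of "\<mu> - \<nu>"] by (auto simp: cis_mult algebra_simps)
  note has_mean_kernel[OF this, of S \<psi>]
  moreover have "(\<Sum>x\<in>S. \<Sum>y\<in>S. cis (\<psi> y - \<psi> x) * (if y - x = \<mu> then 1 else 0)) =
     (\<Sum>x\<in>S. if x + \<mu> \<in> S then cis (\<psi> \<mu>) else 0)"
  proof (rule sum.cong[OF refl])
    fix x
    have "(\<Sum>y\<in>S. cis (\<psi> y - \<psi> x) * (if y - x = \<mu> then 1 else 0)) =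
       (\<Sum>y\<in>S. if y = x + \<mu> then cis (\<psi> \<mu>) else 0)"
      by (intro sum.cong) (auto simp: add)
    then show "(\<Sum>y\<in>S. cis (\<psi> y - \<psi> x) * (if y - x = \<mu> then 1 else 0)) =
       (if x + \<mu> \<in> S then cis (\<psi> \<mu>) else 0)"
      using \<open>finite S\<close> by (simp add: sum.delta)
  qed
  moreover have "\<dots> = of_nat (card {x \<in> S. x + \<mu> \<in> S}) * cis (\<psi> \<mu>)"
    using \<open>finite S\<close> by (simp add: sum.If_cases Int_def)
  ultimately show ?thesis by (simp add: overlap_def mult.commute)
qed

lemma has_mean_kernel_one:
  assumes "finite S" "S \<noteq> {}" "\<And>x y. \<psi> (x + y) = \<psi> x + \<psi> y"
  shows "has_mean (\<lambda>t. of_real (kernel S \<psi> t)) 1"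
proof -
  have "\<psi> 0 = 0" using assms(3)[of 0 0] by simp
  then show ?thesis
    using has_mean_kernel_cis[of S \<psi> 0] assms by (simp add: overlap_def)
qed


section \<open>Almost invariant finite sets and simultaneous approximation\<close>

lemma exists_power_gt_polynomial:
  fixes \<delta> :: real
  assumes "\<delta> > 0"
  shows "\<exists>k. real (Suc k) ^ N < (1 + \<delta>) ^ k"
proof -
  have "(\<lambda>k. real k ^ N / (1 + \<delta>) ^ k) \<longlonglongrightarrow> 0"
    using assms by real_asymp
  \<comment> \<open>The threshold \<open>1 / (1 + \<delta>)\<close> absorbs the one factor by which
    the powers at \<open>Suc k0\<close> and \<open>k0\<close> differ.\<close>
  then have "\<forall>\<^sub>F k in sequentially. real k ^ N / (1 + \<delta>) ^ k < 1 / (1 + \<delta>)"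
    using assms by (intro order_tendstoD) auto
  then obtain k0 where "real (Suc k0) ^ N / (1 + \<delta>) ^ Suc k0 < 1 / (1 + \<delta>)"
    unfolding eventually_sequentially using le_Suc_eq by blast
  then show ?thesis using assms by (intro exI[of _ k0]) (simp add: divide_simps split: if_splits)
qed

text \<open>Polynomial growth of the sets of combinations with coefficients at most \<open>k\<close> forces
  two consecutive ones to be almost of the same size.\<close>

lemma exists_folner_set:
  fixes M :: "real set" and \<delta> :: real
  assumes "finite M" "\<delta> > 0"
  obtains S where "finite S" "S \<noteq> {}" "\<And>\<mu>. \<mu> \<in> M \<Longrightarrow> 1 - \<delta> \<le> overlap S \<mu>"
proof -
  \<comment> \<open>\<open>A k\<close> is a box in the subgroup generated by \<open>M\<close>: all
    combinations with coefficients in \<open>{0..k}\<close>. Shifting by an element of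
    \<open>M\<close> raises one coefficient by one and so lands in \<open>A (Suc k)\<close>.\<close>
  define A where "A k = (\<lambda>v. \<Sum>\<mu>\<in>M. real (v \<mu>) * \<mu>) ` (M \<rightarrow>\<^sub>E {..k})" for k :: nat
  have fin: "finite (A k)" for k
    unfolding A_def using \<open>finite M\<close> by (intro finite_imageI finite_PiE) auto
  have ne: "A k \<noteq> {}" for k
    unfolding A_def by (simp add: PiE_eq_empty_iff)
  have sub: "A k \<subseteq> A (Suc k)" for k
    unfolding A_def by (intro image_mono PiE_mono) auto
  have shift: "x + \<mu> \<in> A (Suc k)" if "x \<in> A k" "\<mu> \<in> M" for x \<mu> k
  proof -
    obtain v where v: "v \<in> M \<rightarrow>\<^sub>E {..k}" "x = (\<Sum>\<mu>\<in>M. real (v \<mu>) * \<mu>)"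
      using \<open>x \<in> A k\<close> by (auto simp: A_def)
    have "x + \<mu> = (\<Sum>\<mu>'\<in>M. real ((v(\<mu> := Suc (v \<mu>))) \<mu>') * \<mu>')"
      using \<open>\<mu> \<in> M\<close> \<open>finite M\<close> v(2)
      by (simp add: sum.remove[of M \<mu>] algebra_simps)
    moreover have "v(\<mu> := Suc (v \<mu>)) \<in> M \<rightarrow>\<^sub>E {..Suc k}"
      using v(1) \<open>\<mu> \<in> M\<close> by (fastforce simp: PiE_iff extensional_def)
    ultimately show ?thesis unfolding A_def by blast
  qed
  have le: "card (A k) \<le> Suc k ^ card M" for k
  proof -
    have "card (A k) \<le> card (M \<rightarrow>\<^sub>E {..k})"
      unfolding A_def using \<open>finite M\<close> by (intro card_image_le finite_PiE) auto
    then show ?thesis using \<open>finite M\<close> by (simp add: card_PiE)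
  qed
  \<comment> \<open>Otherwise \<open>card (A k)\<close> would be at least
    \<open>(1 + \<delta>) ^ k\<close>, against the bound \<open>Suc k ^ card M\<close>.\<close>
  have "\<exists>k. real (card (A (Suc k))) \<le> (1 + \<delta>) * real (card (A k))"
  proof (rule ccontr)
    assume "\<not> ?thesis"
    then have gr: "(1 + \<delta>) * real (card (A k)) \<le> real (card (A (Suc k)))" for k
      by (meson linear)
    have "(1 + \<delta>) ^ k \<le> real (card (A k))" for k
    proof (induction k)
      case 0
      then show ?case using fin[of 0] ne[of 0] by (simp add: Suc_leI card_gt_0_iff)
    next
      case (Suc k)
      then have "(1 + \<delta>) * (1 + \<delta>) ^ k \<le> (1 + \<delta>) * real (card (A k))"
        using \<open>\<delta> > 0\<close> by (intro mult_left_mono) auto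
      with gr[of k] show ?case by simp
    qed
    moreover have "real (card (A k)) \<le> real (Suc k) ^ card M" for k
      using le[of k] by (metis of_nat_le_iff of_nat_power)
    ultimately show False
      using exists_power_gt_polynomial[OF \<open>\<delta> > 0\<close>, of "card M"] by (meson leD order_trans)
  qed
  then obtain k where k: "real (card (A (Suc k))) \<le> (1 + \<delta>) * real (card (A k))" by blast
  show thesis
  proof (rule that[OF fin ne])
    fix \<mu> assume "\<mu> \<in> M"
    let ?B = "(\<lambda>x. x + \<mu>) ` A k"
    \<comment> \<open>\<open>A k\<close> and its shift \<open>?B\<close> both lie in
      \<open>A (Suc k)\<close>, so by inclusion-exclusion they share at least
      \<open>2 * card (A k) - card (A (Suc k))\<close> elements, hence at least
      \<open>(1 - \<delta>) * card (A k)\<close>.\<close>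
    have "card (A k \<inter> ?B) \<le> card {x \<in> A k. x + \<mu> \<in> A k}"
      using fin by (intro surj_card_le[where f = "\<lambda>x. x + \<mu>"]) auto
    moreover have "card (A k) + card ?B = card (A k \<union> ?B) + card (A k \<inter> ?B)"
      by (intro card_Un_Int fin finite_imageI)
    moreover have "card ?B = card (A k)" by (intro card_image) simp
    moreover have "card (A k \<union> ?B) \<le> card (A (Suc k))"
      using fin sub shift[OF _ \<open>\<mu> \<in> M\<close>] by (intro card_mono) auto
    ultimately have "(1 - \<delta>) * real (card (A k)) \<le> real (card {x \<in> A k. x + \<mu> \<in> A k})"
      using k by (simp add: algebra_simps)
    then show "1 - \<delta> \<le> overlap (A k) \<mu>"
      using fin[of k] ne[of k] by (simp add: overlap_def pos_le_divide_eq card_gt_0_iff)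
  qed
qed

text \<open>Kronecker's theorem for possibly dependent frequencies: under the weight \<open>kernel S \<psi>\<close>
  the mean of each \<open>1 - cos (\<mu> j * t - \<psi> (\<mu> j))\<close> is tiny.\<close>

lemma kronecker_additive:
  assumes S: "finite S" "S \<noteq> {}" and add: "\<And>x y. \<psi> (x + y) = \<psi> x + \<psi> y"
    and J: "finite J" "\<And>j. j \<in> J \<Longrightarrow> 1 - \<delta> \<le> overlap S (\<mu> j)"
    and \<eta>: "\<eta> > 0" "real (card J) * \<delta> < \<eta>\<^sup>2 / 2"
  shows "\<exists>t. \<forall>j\<in>J. cmod (cis (\<mu> j * t) - cis (\<psi> (\<mu> j))) < \<eta>"
proof (rule ccontr)
  assume neg: "\<not> ?thesis"
  let ?K = "\<lambda>t. complex_of_real (kernel S \<psi> t)"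
  let ?d = "\<lambda>j t. cis (\<mu> j * t - \<psi> (\<mu> j))"
  \<comment> \<open>The mean of this function has real part \<open>(\<Sum>j\<in>J. 1 - overlap S
    (\<mu> j)) - \<eta>\<^sup>2 / 2\<close>, negative by the choice of \<open>\<delta>\<close>. If
    no \<open>t\<close> were suitable, the function itself would have nonnegative real part
    everywhere.\<close>
  have "has_mean (\<lambda>t. (\<Sum>j\<in>J. ?K t - cis (- \<psi> (\<mu> j)) * (?K t * cis (\<mu> j * t))) - of_real (\<eta>\<^sup>2 / 2) * ?K t)
     ((\<Sum>j\<in>J. 1 - cis (- \<psi> (\<mu> j)) * (cis (\<psi> (\<mu> j)) * of_real (overlap S (\<mu> j)))) - of_real (\<eta>\<^sup>2 / 2) * 1)"
    by (intro has_mean_diff has_mean_sum has_mean_cmult has_mean_kernel_cis has_mean_kernel_one S add)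
  moreover have "cis (- \<psi> (\<mu> j)) * (cis (\<psi> (\<mu> j)) * of_real (overlap S (\<mu> j))) = of_real (overlap S (\<mu> j))" for j
    by (simp add: cis_mult flip: mult.assoc)
  moreover have "(\<Sum>j\<in>J. ?K t - cis (- \<psi> (\<mu> j)) * (?K t * cis (\<mu> j * t))) - of_real (\<eta>\<^sup>2 / 2) * ?K t
     = ?K t * ((\<Sum>j\<in>J. 1 - ?d j t) - of_real (\<eta>\<^sup>2 / 2))" for t
  proof -
    have "cis (- \<psi> (\<mu> j)) * (?K t * cis (\<mu> j * t)) = ?K t * ?d j t" for j
      by (simp add: cis_mult mult.left_commute)
    then show ?thesis by (simp only: sum_distrib_left right_diff_distrib mult_1_right mult.commute[of "complex_of_real (\<eta>\<^sup>2 / 2)"])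
  qed
  ultimately have mean: "has_mean (\<lambda>t. ?K t * ((\<Sum>j\<in>J. 1 - ?d j t) - of_real (\<eta>\<^sup>2 / 2)))
     (of_real ((\<Sum>j\<in>J. 1 - overlap S (\<mu> j)) - \<eta>\<^sup>2 / 2))"
    by simp
  \<comment> \<open>At each \<open>t\<close> some \<open>j\<close> fails, and as the squared
    distance of \<open>cis a\<close> and \<open>cis b\<close> is
    \<open>2 * (1 - cos (a - b))\<close>, its term alone reaches \<open>\<eta>\<^sup>2 / 2\<close>;
    the other terms are nonnegative.\<close>
  have "0 \<le> (\<Sum>j\<in>J. 1 - cos (\<mu> j * t - \<psi> (\<mu> j))) - \<eta>\<^sup>2 / 2" for t
  proof -
    from neg obtain j where j: "j \<in> J" "\<eta> \<le> cmod (cis (\<mu> j * t) - cis (\<psi> (\<mu> j)))" by (meson not_le)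
    have "\<eta>\<^sup>2 \<le> (cmod (cis (\<mu> j * t) - cis (\<psi> (\<mu> j))))\<^sup>2"
      using j \<eta> by (intro power_mono) auto
    also have "\<dots> = 2 * (1 - cos (\<mu> j * t - \<psi> (\<mu> j)))"
    proof -
      have "(cos a - cos b)\<^sup>2 + (sin a - sin b)\<^sup>2 = 2 * (1 - cos (a - b))" for a b :: real
        using sin_cos_squared_add[of a] sin_cos_squared_add[of b]
        by (simp add: cos_diff power2_diff algebra_simps)
      then show ?thesis by (simp add: cmod_power2)
    qed
    also have "1 - cos (\<mu> j * t - \<psi> (\<mu> j)) \<le> (\<Sum>j\<in>J. 1 - cos (\<mu> j * t - \<psi> (\<mu> j)))"
      using j J by (intro member_le_sum) auto
    finally show ?thesis by simp
  qed
  then have "0 \<le> Re (of_real ((\<Sum>j\<in>J. 1 - overlap S (\<mu> j)) - \<eta>\<^sup>2 / 2) :: complex)"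
    by (intro has_mean_Re_nonneg[OF mean]) (auto simp: intro!: mult_nonneg_nonneg kernel_nonneg)
  moreover have "(\<Sum>j\<in>J. 1 - overlap S (\<mu> j)) \<le> real (card J) * \<delta>"
    using J(2) by (intro sum_bounded_above) (auto simp: algebra_simps)
  ultimately show False using \<eta> by simp
qed

section \<open>Weighted means of exponential polynomials\<close>

lemma norm_exp_of_real_mult_le:
  assumes "\<bar>Re s\<bar> \<le> B"
  shows "cmod (exp (of_real \<mu> * s)) \<le> exp (\<bar>\<mu>\<bar> * B)"
proof -
  have "\<mu> * Re s \<le> \<bar>\<mu>\<bar> * \<bar>Re s\<bar>" by (metis abs_ge_self abs_mult)
  also have "\<dots> \<le> \<bar>\<mu>\<bar> * B" using assms by (intro mult_left_mono) auto
  finally show ?thesis by simp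
qed

text \<open>This serves both for the damping of phases by overlaps and for the phases of an actual
  translation. The bound depends on \<open>s\<close> only through \<open>B\<close>, which makes the
  later estimates uniform on a strip.\<close>

lemma norm_exp_poly_diff_le:
  assumes "\<And>j. j \<in> J \<Longrightarrow> cmod (u j - v j) \<le> r" "\<bar>Re s\<bar> \<le> B"
  shows "cmod ((\<Sum>j\<in>J. c j * exp (of_real (\<mu> j) * s) * u j) - (\<Sum>j\<in>J. c j * exp (of_real (\<mu> j) * s) * v j))
    \<le> (\<Sum>j\<in>J. cmod (c j) * exp (\<bar>\<mu> j\<bar> * B)) * r"
proof -
  have "cmod (c j * exp (of_real (\<mu> j) * s) * (u j - v j)) \<le> cmod (c j) * exp (\<bar>\<mu> j\<bar> * B) * r" if "j \<in> J" for j
    unfolding norm_mult using assms that norm_exp_of_real_mult_le[OF assms(2), of "\<mu> j"]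
    by (intro mult_mono) auto
  then have "cmod (\<Sum>j\<in>J. c j * exp (of_real (\<mu> j) * s) * (u j - v j)) \<le> (\<Sum>j\<in>J. cmod (c j) * exp (\<bar>\<mu> j\<bar> * B) * r)"
    by (rule sum_norm_le)
  then show ?thesis by (simp add: sum_subtractf right_diff_distrib sum_distrib_right)
qed

lemma exp_poly_shift:
  "(\<Sum>j\<in>J. c j * exp (of_real (\<mu> j) * (s + \<i> * of_real t))) =
   (\<Sum>j\<in>J. c j * exp (of_real (\<mu> j) * s) * cis (\<mu> j * t))"
  by (simp add: cis_conv_exp distrib_left exp_add mult_ac)

text \<open>Replacing \<open>f\<close> by the polynomial costs \<open>e\<close>, because the weight
  is nonnegative with mean 1. Dropping the overlap factors, which lie between
  \<open>1 - \<delta>\<close> and 1, costs the second term.\<close>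

lemma kernel_mean_exp_poly:
  assumes S: "finite S" "S \<noteq> {}" and add: "\<And>x y. \<psi> (x + y) = \<psi> x + \<psi> y"
    and J: "\<And>j. j \<in> J \<Longrightarrow> 1 - \<delta> \<le> overlap S (\<mu> j)" and B: "\<bar>Re s\<bar> \<le> B"
    and f: "has_mean (\<lambda>t. of_real (kernel S \<psi> t) * f (s + \<i> * of_real t)) m"
    and P: "\<And>z. Re z = Re s \<Longrightarrow> cmod (f z - (\<Sum>j\<in>J. c j * exp (of_real (\<mu> j) * z))) \<le> e"
  shows "cmod (m - (\<Sum>j\<in>J. c j * exp (of_real (\<mu> j) * s) * cis (\<psi> (\<mu> j))))
     \<le> e + (\<Sum>j\<in>J. cmod (c j) * exp (\<bar>\<mu> j\<bar> * B)) * \<delta>"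
proof -
  let ?K = "\<lambda>t. complex_of_real (kernel S \<psi> t)"
  let ?P = "\<lambda>z. \<Sum>j\<in>J. c j * exp (of_real (\<mu> j) * z)"
  define p where "p = (\<Sum>j\<in>J. c j * exp (of_real (\<mu> j) * s) * (cis (\<psi> (\<mu> j)) * of_real (overlap S (\<mu> j))))"
  have "has_mean (\<lambda>t. \<Sum>j\<in>J. c j * exp (of_real (\<mu> j) * s) * (?K t * cis (\<mu> j * t))) p"
    unfolding p_def by (intro has_mean_sum has_mean_cmult has_mean_kernel_cis S add)
  then have "has_mean (\<lambda>t. ?K t * ?P (s + \<i> * of_real t)) p"
    unfolding exp_poly_shift by (simp add: sum_distrib_left mult_ac)
  from has_mean_diff[OF f this] has_mean_kernel_one[OF S add]
  have "cmod (m - p) \<le> e"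
  proof (rule has_mean_bound)
    fix t
    have "cmod (f (s + \<i> * of_real t) - ?P (s + \<i> * of_real t)) \<le> e" by (intro P) simp
    from mult_left_mono[OF this kernel_nonneg[of S \<psi> t]]
    show "cmod (?K t * f (s + \<i> * of_real t) - ?K t * ?P (s + \<i> * of_real t)) \<le> e * kernel S \<psi> t"
      by (simp add: norm_mult kernel_nonneg mult.commute flip: right_diff_distrib)
  qed
  moreover have "cmod (p - (\<Sum>j\<in>J. c j * exp (of_real (\<mu> j) * s) * cis (\<psi> (\<mu> j))))
     \<le> (\<Sum>j\<in>J. cmod (c j) * exp (\<bar>\<mu> j\<bar> * B)) * \<delta>"
    unfolding p_def
  proof (rule norm_exp_poly_diff_le[OF _ B])
    fix j assume "j \<in> J"
    have "cis (\<psi> (\<mu> j)) * of_real (overlap S (\<mu> j)) - cis (\<psi> (\<mu> j)) =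
      cis (\<psi> (\<mu> j)) * of_real (overlap S (\<mu> j) - 1)" by (simp add: algebra_simps)
    then have "cmod (cis (\<psi> (\<mu> j)) * of_real (overlap S (\<mu> j)) - cis (\<psi> (\<mu> j))) = \<bar>overlap S (\<mu> j) - 1\<bar>"
      by (simp only: norm_mult norm_cis norm_of_real mult_1)
    then show "cmod (cis (\<psi> (\<mu> j)) * of_real (overlap S (\<mu> j)) - cis (\<psi> (\<mu> j))) \<le> \<delta>"
      using J[OF \<open>j \<in> J\<close>] overlap_le_1[OF S, of "\<mu> j"] by linarith
  qed
  ultimately show ?thesis
    by (smt (verit) norm_diff_triangle_ineq norm_triangle_sub diff_add_cancel add_diff_eq norm_triangle_ineq)
qed

section \<open>Equivalence realised by additive maps on all reals\<close>

text \<open>The kernel evaluates \<open>\<psi>\<close> at arbitrary points of \<open>S\<close>, so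
  additivity on all of the reals is wanted. A rational basis chosen inside \<open>F\<close>
  determines \<open>\<psi>\<close> on \<open>F\<close>, and a linear map prescribed on it extends to
  the whole space.\<close>

lemma rat_linear_extension:
  assumes \<psi>: "rat_linear_on (rat_span F) \<psi>"
  obtains \<phi> :: "real \<Rightarrow> real" where "\<And>x y. \<phi> (x + y) = \<phi> x + \<phi> y" "\<And>x. x \<in> F \<Longrightarrow> \<phi> x = \<psi> x"
proof -
  interpret vs: vector_space rat_scale by (rule vector_space_rat_scale)
  interpret vp: vector_space_pair rat_scale rat_scale by unfold_locales
  obtain B where B: "B \<subseteq> F" "vs.independent B" "F \<subseteq> vs.span B"
    using vs.maximal_independent_subset[of F] by metis
  obtain \<phi> where \<phi>: "Vector_Spaces.linear rat_scale rat_scale \<phi>" "\<forall>x\<in>B. \<phi> x = \<psi> x"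
    using vp.linear_independent_extend[OF B(2)] by blast
  interpret \<phi>: Vector_Spaces.linear rat_scale rat_scale \<phi> by fact
  \<comment> \<open>Membership in \<open>vs.span F\<close> is carried through the induction because
    \<open>\<psi>\<close> is linear only there.\<close>
  have "x \<in> vs.span F \<and> \<phi> x = \<psi> x" if "x \<in> vs.span B" for x
    using that
  proof (induction rule: vs.span_induct_alt)
    case base
    have "0 \<in> vs.span F" by (rule vs.span_zero)
    then have "\<psi> (0 + 0) = \<psi> 0 + \<psi> 0" using \<psi> unfolding rat_linear_on_def rat_span_def by blast
    then show ?case using vs.span_zero by (simp add: \<phi>.zero)
  next
    case (step q x y)
    then have x: "x \<in> vs.span F" "\<phi> x = \<psi> x" using B \<phi>(2) vs.span_base by auto
    have y: "y \<in> vs.span F" "\<phi> y = \<psi> y" using step.IH by auto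
    have qx: "rat_scale q x \<in> vs.span F" using x by (intro vs.span_scale)
    have "\<psi> (rat_scale q x + y) = \<psi> (rat_scale q x) + \<psi> y"
      using \<psi> qx y(1) unfolding rat_linear_on_def rat_span_def by blast
    also have "\<psi> (rat_scale q x) = rat_scale q (\<psi> x)"
      using \<psi> x(1) unfolding rat_linear_on_def rat_span_def by blast
    finally have "\<phi> (rat_scale q x + y) = \<psi> (rat_scale q x + y)"
      using x(2) y(2) by (simp only: \<phi>.add \<phi>.scale)
    then show ?case using vs.span_add[OF qx y(1)] by blast
  qed
  then show thesis using that[of \<phi>] B(3) \<phi>.add by blast
qed

text \<open>Frequencies outside \<open>\<Lambda>\<close> have coefficient 0 for both functions, so
  any phase fits them. The others in \<open>F\<close> have finitely many indices, and the linear map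
  for the largest index handles them all.\<close>

lemma star_equiv_finite:
  assumes enum: "enumerates lam \<Lambda>" and f: "f1 \<in> D_class \<alpha> \<beta> \<Lambda>" "f2 \<in> D_class \<alpha> \<beta> \<Lambda>"
    and eq: "star_equiv \<alpha> \<beta> \<Lambda> lam f1 f2" and "finite F"
  obtains \<psi> where "\<And>x y. \<psi> (x + y) = \<psi> x + \<psi> y"
    "\<And>\<nu>. \<nu> \<in> F \<Longrightarrow> dirichlet_coeff \<alpha> \<beta> f2 \<nu> = dirichlet_coeff \<alpha> \<beta> f1 \<nu> * cis (\<psi> \<nu>)"
proof -
  define I where "I = {j \<in> indices \<Lambda>. lam j \<in> F}"
  have inj: "inj_on lam (indices \<Lambda>)" and img: "lam ` indices \<Lambda> = \<Lambda>"
    using enum by (auto simp: enumerates_def bij_betw_def)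
  have "finite I"
  proof (rule finite_imageD)
    show "inj_on lam I" using inj by (rule inj_on_subset) (auto simp: I_def)
    show "finite (lam ` I)" by (rule finite_subset[OF _ \<open>finite F\<close>]) (auto simp: I_def)
  qed
  have out: "dirichlet_coeff \<alpha> \<beta> f1 \<nu> = 0 \<and> dirichlet_coeff \<alpha> \<beta> f2 \<nu> = 0" if "\<nu> \<notin> \<Lambda>" for \<nu>
    using f that by (simp add: D_class_def)
  have cases: "\<nu> \<notin> \<Lambda> \<or> \<nu> \<in> lam ` I" if "\<nu> \<in> F" for \<nu>
    using that img by (auto simp: I_def)
  show thesis
  proof (cases "I = {}")
    case True
    with cases out show ?thesis by (intro that[of "\<lambda>_. 0"]) auto
  next
    case False
    with \<open>finite I\<close> have "Max I \<in> indices \<Lambda>" using Max_in[of I] by (auto simp: I_def)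
    with eq obtain \<psi> where \<psi>: "rat_linear_on (rat_span (lam ` {1..Max I})) \<psi>"
      "\<forall>j\<in>{1..Max I}. dirichlet_coeff \<alpha> \<beta> f2 (lam j) =
           dirichlet_coeff \<alpha> \<beta> f1 (lam j) * exp (\<i> * of_real (\<psi> (lam j)))"
      unfolding star_equiv_def by blast
    obtain \<phi> where \<phi>: "\<And>x y. \<phi> (x + y) = \<phi> x + \<phi> y" "\<And>x. x \<in> lam ` {1..Max I} \<Longrightarrow> \<phi> x = \<psi> x"
      using rat_linear_extension[OF \<psi>(1)] by metis
    have "I \<subseteq> {1..Max I}" using \<open>finite I\<close> by (auto simp: I_def indices_def)
    then have "dirichlet_coeff \<alpha> \<beta> f2 (lam j) = dirichlet_coeff \<alpha> \<beta> f1 (lam j) * cis (\<phi> (lam j))" if "j \<in> I" for j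
      using \<psi>(2) \<phi>(2) that by (force simp: cis_conv_exp)
    then show ?thesis using cases out by (intro that[of \<phi>] \<phi>(1)) fastforce
  qed
qed

lemma star_equiv_sym:
  assumes "star_equiv \<alpha> \<beta> \<Lambda> lam f1 f2"
  shows "star_equiv \<alpha> \<beta> \<Lambda> lam f2 f1"
  unfolding star_equiv_def
proof
  fix n assume "n \<in> indices \<Lambda>"
  with assms obtain \<psi> where \<psi>: "rat_linear_on (rat_span (lam ` {1..n})) \<psi>"
    "\<forall>j\<in>{1..n}. dirichlet_coeff \<alpha> \<beta> f2 (lam j) =
         dirichlet_coeff \<alpha> \<beta> f1 (lam j) * exp (\<i> * of_real (\<psi> (lam j)))"
    unfolding star_equiv_def by blast
  then have "rat_linear_on (rat_span (lam ` {1..n})) (\<lambda>x. - \<psi> x)"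
    by (auto simp: rat_linear_on_def)
  moreover have "\<forall>j\<in>{1..n}. dirichlet_coeff \<alpha> \<beta> f1 (lam j) =
         dirichlet_coeff \<alpha> \<beta> f2 (lam j) * exp (\<i> * of_real (- \<psi> (lam j)))"
    using \<psi>(2) by (simp add: mult.assoc flip: exp_add)
  ultimately show "\<exists>\<psi>. rat_linear_on (rat_span (lam ` {1..n})) \<psi> \<and>
      (\<forall>j\<in>{1..n}. dirichlet_coeff \<alpha> \<beta> f1 (lam j) =
         dirichlet_coeff \<alpha> \<beta> f2 (lam j) * exp (\<i> * of_real (\<psi> (lam j))))"
    by blast
qed

section \<open>A vertical translate of \<open>f1\<close> close to \<open>f2\<close>\<close>

text \<open>The chain of comparisons is: \<open>f1\<close> at \<open>s + \<i> * \<tau>\<close>, its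
  polynomial there, that polynomial with phases \<open>\<psi> (\<mu> j)\<close>, the common weighted
  mean \<open>m\<close>, the polynomial of \<open>f2\<close>, and \<open>f2 s\<close>. All of
  \<open>S\<close>, \<open>\<psi>\<close> and \<open>\<tau>\<close> are fixed before
  \<open>s\<close>, whence uniformity.\<close>

lemma star_equiv_translate:
  assumes enum: "enumerates lam \<Lambda>" and f: "f1 \<in> D_class \<alpha> \<beta> \<Lambda>" "f2 \<in> D_class \<alpha> \<beta> \<Lambda>"
    and eq: "star_equiv \<alpha> \<beta> \<Lambda> lam f1 f2"
    and ab: "\<alpha> < ereal a" "a < b" "ereal b < \<beta>" and "e > 0"
  shows "\<exists>\<tau>. \<forall>s. a \<le> Re s \<and> Re s \<le> b \<longrightarrow> cmod (f1 (s + \<i> * of_real \<tau>) - f2 s) < e"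
proof -
  have AP: "f1 \<in> AP \<alpha> \<beta>" "f2 \<in> AP \<alpha> \<beta>" using f by (auto simp: D_class_def)
  have "e / 8 > 0" using \<open>e > 0\<close> by simp
  obtain n c \<mu> where P: "\<And>s. a \<le> Re s \<Longrightarrow> Re s \<le> b \<Longrightarrow>
      cmod (f1 s - (\<Sum>j=1..n::nat. c j * exp (of_real (\<mu> j) * s))) < e / 8"
    using AP_approx[OF AP(1) ab \<open>e / 8 > 0\<close>] by metis
  obtain n' c' \<mu>' where Q: "\<And>s. a \<le> Re s \<Longrightarrow> Re s \<le> b \<Longrightarrow>
      cmod (f2 s - (\<Sum>j=1..n'::nat. c' j * exp (of_real (\<mu>' j) * s))) < e / 8"
    using AP_approx[OF AP(2) ab \<open>e / 8 > 0\<close>] by metis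
  define B where "B = max \<bar>a\<bar> \<bar>b\<bar>"
  define C where "C = (\<Sum>j=1..n. cmod (c j) * exp (\<bar>\<mu> j\<bar> * B))"
  define C' where "C' = (\<Sum>j=1..n'. cmod (c' j) * exp (\<bar>\<mu>' j\<bar> * B))"
  have C: "C \<ge> 0" "C' \<ge> 0" unfolding C_def C'_def by (auto intro: sum_nonneg)
  \<comment> \<open>Chosen so that \<open>C * \<eta>\<close> and \<open>C' * \<eta>\<close> are at
    most \<open>e / 8\<close>; the summand 1 keeps the denominator positive when both constants
    vanish.\<close>
  define \<eta> where "\<eta> = e / (8 * (C + C' + 1))"
  have \<eta>: "\<eta> > 0" using C \<open>e > 0\<close> by (simp add: \<eta>_def)
  have "K * (e / (8 * K)) = e / 8" if "K > 0" for K using that by simp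
  from this[of "C + C' + 1"] have "(C + C' + 1) * \<eta> = e / 8" using C by (simp only: \<eta>_def)
  moreover have "C * \<eta> \<le> (C + C' + 1) * \<eta>" "C' * \<eta> \<le> (C + C' + 1) * \<eta>"
    using C \<eta> by (auto intro!: mult_right_mono)
  ultimately have C\<eta>: "C * \<eta> \<le> e / 8" "C' * \<eta> \<le> e / 8" by linarith+
  \<comment> \<open>The bound by \<open>\<eta>\<close> controls the overlap errors; the second bound
    yields the smallness condition of \<open>kronecker_additive\<close>, with \<open>n + 1\<close>
    covering \<open>n = 0\<close>.\<close>
  define \<delta> where "\<delta> = min \<eta> (\<eta>\<^sup>2 / (4 * (real n + 1)))"
  have \<delta>: "\<delta> > 0" "\<delta> \<le> \<eta>" using \<eta> by (auto simp: \<delta>_def)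
  have "real n * \<delta> \<le> real n * (\<eta>\<^sup>2 / (4 * (real n + 1)))" by (intro mult_left_mono) (auto simp: \<delta>_def)
  also have "\<dots> < \<eta>\<^sup>2 / 2"
  proof -
    have "\<eta>\<^sup>2 * (2 * real n) < \<eta>\<^sup>2 * (4 * (real n + 1))"
      using \<eta> by (intro mult_strict_left_mono) auto
    then show ?thesis by (simp add: field_simps)
  qed
  finally have n\<delta>: "real (card {1..n}) * \<delta> < \<eta>\<^sup>2 / 2" by simp
  obtain S where S: "finite S" "S \<noteq> {}" and ov: "\<And>\<nu>. \<nu> \<in> \<mu> ` {1..n} \<union> \<mu>' ` {1..n'} \<Longrightarrow> 1 - \<delta> \<le> overlap S \<nu>"
    using exists_folner_set[OF _ \<open>\<delta> > 0\<close>, of "\<mu> ` {1..n} \<union> \<mu>' ` {1..n'}"] by auto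
  \<comment> \<open>The differences of elements of \<open>S\<close> are exactly the frequencies at
    which the kernel samples the coefficients.\<close>
  have "finite ((\<lambda>(x, y). y - x) ` (S \<times> S))" using S by auto
  then obtain \<psi> where add: "\<And>x y. \<psi> (x + y) = \<psi> x + \<psi> y" and
    "\<And>\<nu>. \<nu> \<in> (\<lambda>(x, y). y - x) ` (S \<times> S) \<Longrightarrow>
      dirichlet_coeff \<alpha> \<beta> f2 \<nu> = dirichlet_coeff \<alpha> \<beta> f1 \<nu> * cis (\<psi> \<nu>)"
    using star_equiv_finite[OF enum f eq, of "(\<lambda>(x, y). y - x) ` (S \<times> S)"] by metis
  then have coeff: "dirichlet_coeff \<alpha> \<beta> f2 (y - x) = dirichlet_coeff \<alpha> \<beta> f1 (y - x) * cis (\<psi> (y - x))"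
    if "x \<in> S" "y \<in> S" for x y
    using that by force
  obtain \<tau> where \<tau>: "\<forall>j\<in>{1..n}. cmod (cis (\<mu> j * \<tau>) - cis (\<psi> (\<mu> j))) < \<eta>"
    using kronecker_additive[OF S add _ _ \<eta> n\<delta>, of \<mu>] ov by auto
  have "cmod (f1 (s + \<i> * of_real \<tau>) - f2 s) < e" if s: "a \<le> Re s" "Re s \<le> b" for s
  proof -
    have s': "\<alpha> < ereal (Re s)" "ereal (Re s) < \<beta>"
      using s ab by (meson ereal_less_eq(3) less_le_trans le_less_trans)+
    have B: "\<bar>Re s\<bar> \<le> B" using s by (auto simp: B_def)
    define m where "m = (\<Sum>x\<in>S. \<Sum>y\<in>S. cis (\<psi> y - \<psi> x) *
       (dirichlet_coeff \<alpha> \<beta> f1 (y - x) * exp (of_real (y - x) * s))) / of_nat (card S)"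
    have m1: "has_mean (\<lambda>t. of_real (kernel S \<psi> t) * f1 (s + \<i> * of_real t)) m"
      unfolding m_def by (intro has_mean_kernel has_mean_dirichlet_coeff AP s')
    have diff: "\<psi> (y - x) = \<psi> y - \<psi> x" for x y using add[of "y - x" x] by simp
    \<comment> \<open>Term by term the phase \<open>cis (\<psi> y - \<psi> x)\<close> converts a
      coefficient of \<open>f1\<close> into one of \<open>f2\<close>. The trivial factor
      \<open>cis (0 - 0)\<close> displays the result as the kernel mean for
      \<open>\<psi> = 0\<close>.\<close>
    have "m = (\<Sum>x\<in>S. \<Sum>y\<in>S. cis (0 - 0) *
       (dirichlet_coeff \<alpha> \<beta> f2 (y - x) * exp (of_real (y - x) * s))) / of_nat (card S)"
      unfolding m_def
    proof (intro arg_cong2[where f = "(/)"] sum.cong refl)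
      fix x y assume "x \<in> S" "y \<in> S"
      show "cis (\<psi> y - \<psi> x) * (dirichlet_coeff \<alpha> \<beta> f1 (y - x) * exp (of_real (y - x) * s)) =
         cis (0 - 0) * (dirichlet_coeff \<alpha> \<beta> f2 (y - x) * exp (of_real (y - x) * s))"
        unfolding coeff[OF \<open>x \<in> S\<close> \<open>y \<in> S\<close>] diff by simp
    qed
    then have m2: "has_mean (\<lambda>t. of_real (kernel S (\<lambda>_. 0) t) * f2 (s + \<i> * of_real t)) m"
      using has_mean_kernel[OF has_mean_dirichlet_coeff[OF AP(2) s'], of S "\<lambda>_. 0"] by (simp only:)
    have 1: "cmod (m - (\<Sum>j=1..n. c j * exp (of_real (\<mu> j) * s) * cis (\<psi> (\<mu> j)))) \<le> e / 8 + C * \<delta>"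
      unfolding C_def
    proof (rule kernel_mean_exp_poly[OF S add _ B m1])
      show "1 - \<delta> \<le> overlap S (\<mu> j)" if "j \<in> {1..n}" for j using that by (intro ov) auto
      show "cmod (f1 z - (\<Sum>j=1..n. c j * exp (of_real (\<mu> j) * z))) \<le> e / 8" if "Re z = Re s" for z
        using s that by (intro less_imp_le[OF P]) auto
    qed
    have 2: "cmod (m - (\<Sum>j=1..n'. c' j * exp (of_real (\<mu>' j) * s) * cis 0)) \<le> e / 8 + C' * \<delta>"
      unfolding C'_def
    proof (rule kernel_mean_exp_poly[OF S _ _ B m2])
      show "1 - \<delta> \<le> overlap S (\<mu>' j)" if "j \<in> {1..n'}" for j using that by (intro ov) auto
      show "cmod (f2 z - (\<Sum>j=1..n'. c' j * exp (of_real (\<mu>' j) * z))) \<le> e / 8" if "Re z = Re s" for z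
        using s that by (intro less_imp_le[OF Q]) auto
    qed simp
    have 3: "cmod ((\<Sum>j=1..n. c j * exp (of_real (\<mu> j) * s) * cis (\<mu> j * \<tau>))
        - (\<Sum>j=1..n. c j * exp (of_real (\<mu> j) * s) * cis (\<psi> (\<mu> j)))) \<le> C * \<eta>"
      unfolding C_def using \<tau> by (intro norm_exp_poly_diff_le B) (auto intro: less_imp_le)
    have 4: "cmod (f1 (s + \<i> * of_real \<tau>) - (\<Sum>j=1..n. c j * exp (of_real (\<mu> j) * s) * cis (\<mu> j * \<tau>))) < e / 8"
      using P[of "s + \<i> * of_real \<tau>"] s unfolding exp_poly_shift by simp
    have 5: "cmod (f2 s - (\<Sum>j=1..n'. c' j * exp (of_real (\<mu>' j) * s) * cis 0)) < e / 8"
      using Q[OF s] by simp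
    \<comment> \<open>With \<open>\<delta> \<le> \<eta>\<close> the five errors are at most
      \<open>2e/8\<close>, \<open>2e/8\<close>, \<open>e/8\<close>, \<open>e/8\<close> and
      \<open>e/8\<close>, in total less than \<open>e\<close>.\<close>
    have tri: "cmod (x - y) < A + A' + A'' + D + D'"
      if "cmod (m - q) \<le> A" "cmod (m - r) \<le> A'" "cmod (p - q) \<le> A''" "cmod (x - p) < D" "cmod (y - r) < D'"
      for x y p q r A A' A'' D D'
      using norm_triangle_ineq[of "x - p" "p - q"] norm_triangle_ineq4[of "x - q" "m - q"]
        norm_triangle_ineq[of "x - m" "m - r"] norm_triangle_ineq4[of "x - r" "y - r"] that
      by simp
    have "C * \<delta> \<le> C * \<eta>" "C' * \<delta> \<le> C' * \<eta>" using C \<delta> by (auto intro: mult_left_mono)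
    with tri[OF 1 2 3 4 5] C\<eta> \<open>e > 0\<close> show ?thesis by linarith
  qed
  then show ?thesis by blast
qed

section \<open>Holomorphy and the Hurwitz argument\<close>

lemma AP_holomorphic:
  assumes f: "f \<in> AP \<alpha> \<beta>" and ab: "\<alpha> < ereal a" "a < b" "ereal b < \<beta>"
  shows "f holomorphic_on {s. a < Re s \<and> Re s < b}"
proof -
  let ?U = "{s. a < Re s \<and> Re s < b}"
  have "\<exists>n c \<mu>. \<forall>s. a \<le> Re s \<longrightarrow> Re s \<le> b \<longrightarrow>
      cmod (f s - (\<Sum>j=1..n::nat. c j * exp (of_real (\<mu> j) * s))) < 1 / real (Suc k)" for k
  proof -
    have "1 / real (Suc k) > 0" by simp
    from AP_approx[OF f ab this] show ?thesis by metis
  qed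
  then obtain n c \<mu> where P: "\<And>k s. a \<le> Re s \<Longrightarrow> Re s \<le> b \<Longrightarrow>
      cmod (f s - (\<Sum>j=1..n k::nat. c k j * exp (of_real (\<mu> k j) * s))) < 1 / real (Suc k)"
    by (metis (no_types))
  show ?thesis
  proof (rule holomorphic_uniform_sequence)
    show "open ?U"
      using open_Int[OF open_halfspace_Re_gt[of a] open_halfspace_Re_lt[of b]] by (simp add: Int_def)
    fix x assume "x \<in> ?U"
    then obtain d where d: "d > 0" "cball x d \<subseteq> ?U" using \<open>open ?U\<close> open_contains_cball by blast
    have "uniform_limit (cball x d) (\<lambda>k s. \<Sum>j=1..n k. c k j * exp (of_real (\<mu> k j) * s)) f sequentially"
      unfolding uniform_limit_iff
    proof (intro allI impI)
      fix e :: real assume "e > 0"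
      have "eventually (\<lambda>k. 1 / real (Suc k) < e) sequentially"
        using order_tendstoD(2)[OF LIMSEQ_inverse_real_of_nat \<open>e > 0\<close>] by (simp add: inverse_eq_divide)
      then show "\<forall>\<^sub>F k in sequentially. \<forall>s\<in>cball x d. dist (\<Sum>j=1..n k. c k j * exp (of_real (\<mu> k j) * s)) (f s) < e"
      proof eventually_elim
        case (elim k)
        show ?case
        proof
          fix s assume "s \<in> cball x d"
          with d have "a \<le> Re s" "Re s \<le> b" by auto
          from P[OF this, of k] elim
          show "dist (\<Sum>j=1..n k. c k j * exp (of_real (\<mu> k j) * s)) (f s) < e"
            by (simp add: dist_norm norm_minus_commute)
        qed
      qed
    qed
    with d show "\<exists>d>0. cball x d \<subseteq> ?U \<and>
        uniform_limit (cball x d) (\<lambda>k s. \<Sum>j=1..n k. c k j * exp (of_real (\<mu> k j) * s)) f sequentially"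
      by blast
  qed (auto intro!: holomorphic_intros)
qed

text \<open>Without a zero, \<open>1 / g\<close> would be holomorphic on the disc and bounded by
  \<open>1 / d\<close> on the circle; the maximum modulus principle would then force
  \<open>d \<le> cmod (g z)\<close> at the centre.\<close>

lemma zero_if_small_center:
  fixes g :: "complex \<Rightarrow> complex"
  assumes g: "g holomorphic_on cball z r" and "r > 0" "d > 0"
    and bd: "\<And>w. w \<in> sphere z r \<Longrightarrow> d \<le> cmod (g w)" and c: "cmod (g z) < d"
  shows "\<exists>w\<in>cball z r. g w = 0"
proof (rule ccontr)
  assume "\<not> ?thesis"
  then have nz: "\<And>w. w \<in> cball z r \<Longrightarrow> g w \<noteq> 0" by blast
  have hol: "(\<lambda>w. inverse (g w)) holomorphic_on cball z r"
    using g nz by (intro holomorphic_intros) auto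
  have "cmod (inverse (g z)) \<le> inverse d"
  proof (rule maximum_modulus_frontier[where S = "cball z r" and f = "\<lambda>w. inverse (g w)"])
    show "(\<lambda>w. inverse (g w)) holomorphic_on interior (cball z r)"
      using hol by (rule holomorphic_on_subset) (rule interior_subset)
    show "continuous_on (closure (cball z r)) (\<lambda>w. inverse (g w))"
      using hol holomorphic_on_imp_continuous_on by auto
    show "cmod (inverse (g w)) \<le> inverse d" if "w \<in> frontier (cball z r)" for w
      using bd[of w] that \<open>r > 0\<close> \<open>d > 0\<close> by (simp add: norm_inverse le_imp_inverse_le)
  qed (use \<open>r > 0\<close> in auto)
  moreover have "cmod (g z) > 0" using nz[of z] \<open>r > 0\<close> by simp
  ultimately show False using c \<open>d > 0\<close> by (simp add: norm_inverse)
qed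

text \<open>A closed strip around \<open>s0\<close> with abscissas in \<open>E\<close> is fixed
  first. A vertical translation does not change real parts, so a value found for the translated
  function is a value of \<open>f1\<close> over \<open>E\<close>.\<close>

lemma star_equiv_image_subset:
  assumes enum: "enumerates lam \<Lambda>" and f: "f1 \<in> D_class \<alpha> \<beta> \<Lambda>" "f2 \<in> D_class \<alpha> \<beta> \<Lambda>"
    and eq: "star_equiv \<alpha> \<beta> \<Lambda> lam f1 f2"
    and E: "open E" "\<forall>\<sigma>\<in>E. \<alpha> < ereal \<sigma> \<and> ereal \<sigma> < \<beta>" and s0: "Re s0 \<in> E"
  shows "\<exists>s. Re s \<in> E \<and> f1 s = f2 s0"
proof -
  obtain R where "R > 0" and R: "cball (Re s0) R \<subseteq> E"
    using E(1) s0 open_contains_cball by blast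
  define a b where "a = Re s0 - R" and "b = Re s0 + R"
  have abE: "x \<in> E" if "a \<le> x" "x \<le> b" for x
    using that R by (force simp: a_def b_def dist_real_def)
  have ab: "\<alpha> < ereal a" "a < b" "ereal b < \<beta>"
    using E(2) abE[of a] abE[of b] \<open>R > 0\<close> by (auto simp: a_def b_def)
  note translate = star_equiv_translate[OF enum f eq ab]
  let ?U = "{s. a < Re s \<and> Re s < b}"
  have U: "open ?U" "connected ?U" "s0 \<in> ?U"
  proof -
    have "?U = {s. a < Re s} \<inter> {s. Re s < b}" by auto
    then show "open ?U" "connected ?U"
      by (simp_all add: open_Int open_halfspace_Re_gt open_halfspace_Re_lt
          convex_Int convex_halfspace_Re_gt convex_halfspace_Re_lt convex_connected)
    show "s0 \<in> ?U" using \<open>R > 0\<close> by (simp add: a_def b_def)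
  qed
  have hol: "f1 holomorphic_on ?U" "f2 holomorphic_on ?U"
    using f ab by (auto simp: D_class_def intro: AP_holomorphic)
  let ?g = "\<lambda>s. f2 s - f2 s0"
  show ?thesis
  proof (cases "\<forall>s\<in>?U. ?g s = 0")
    \<comment> \<open>Here \<open>f2\<close> is constant on the strip and has no isolated zeros to
      follow. Evaluating the translate at \<open>s0 - \<i> * \<tau>\<close> shows instead that
      \<open>f1 s0\<close> is arbitrarily close to that constant.\<close>
    case True
    have "cmod (f1 s0 - f2 s0) \<le> 0 + e" if "0 < e" for e
    proof -
      obtain \<tau> where \<tau>: "\<forall>s. a \<le> Re s \<and> Re s \<le> b \<longrightarrow> cmod (f1 (s + \<i> * of_real \<tau>) - f2 s) < e"
        using translate[OF \<open>0 < e\<close>] by blast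
      show ?thesis
        using \<tau>[rule_format, of "s0 - \<i> * of_real \<tau>"] True[rule_format, of "s0 - \<i> * of_real \<tau>"] U(3) by simp
    qed
    then have "cmod (f1 s0 - f2 s0) \<le> 0" by (rule field_le_epsilon)
    then show ?thesis using s0 by (intro exI[of _ s0]) simp
  next
    case False
    then obtain s1 where s1: "s1 \<in> ?U" "?g s1 \<noteq> 0" by blast
    have "?g holomorphic_on ?U" using hol by (intro holomorphic_intros)
    from isolated_zeros[OF this U _ s1] obtain r where r: "r > 0" "ball s0 r \<subseteq> ?U"
      "\<And>z. z \<in> ball s0 r - {s0} \<Longrightarrow> ?g z \<noteq> 0" by auto
    \<comment> \<open>Halving the radius keeps the closed disc inside the ball, so \<open>?g\<close>
      has no zero on the circle.\<close>
    define \<rho> where "\<rho> = r / 2"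
    have \<rho>: "\<rho> > 0" "cball s0 \<rho> \<subseteq> ball s0 r" using r(1) by (auto simp: \<rho>_def)
    have sph: "sphere s0 \<rho> \<subseteq> ball s0 r - {s0}" using \<rho> by auto
    obtain z where z: "z \<in> sphere s0 \<rho>" "\<And>w. w \<in> sphere s0 \<rho> \<Longrightarrow> cmod (?g z) \<le> cmod (?g w)"
    proof -
      have "continuous_on (sphere s0 \<rho>) (\<lambda>s. cmod (?g s))"
        using hol(2) sph r(2)
        by (intro continuous_on_norm continuous_on_diff continuous_on_const
            continuous_on_subset[OF holomorphic_on_imp_continuous_on[OF hol(2)]]) blast
      moreover have "sphere s0 \<rho> \<noteq> {}" using \<rho> by simp
      ultimately show thesis
        using continuous_attains_inf[of "sphere s0 \<rho>" "\<lambda>s. cmod (?g s)"] that by auto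
    qed
    \<comment> \<open>Half the minimum of the modulus of \<open>?g\<close> on the circle: a
      perturbation below \<open>d\<close> leaves at least \<open>d\<close> there, while at the
      centre, where \<open>?g\<close> vanishes, it leaves less than \<open>d\<close>.\<close>
    define d where "d = cmod (?g z) / 2"
    have "d > 0" using r(3)[OF subsetD[OF sph z(1)]] by (simp add: d_def)
    obtain \<tau> where \<tau>: "\<forall>s. a \<le> Re s \<and> Re s \<le> b \<longrightarrow> cmod (f1 (s + \<i> * of_real \<tau>) - f2 s) < d"
      using translate[OF \<open>d > 0\<close>] by blast
    have sub: "cball s0 \<rho> \<subseteq> ?U" using \<rho> r by blast
    have "\<exists>w\<in>cball s0 \<rho>. f1 (w + \<i> * of_real \<tau>) - f2 s0 = 0"
    proof (rule zero_if_small_center[OF _ \<open>\<rho> > 0\<close> \<open>d > 0\<close>])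
      have "(f1 \<circ> (\<lambda>w. w + \<i> * of_real \<tau>)) holomorphic_on cball s0 \<rho>"
        using sub by (intro holomorphic_on_compose_gen[OF _ hol(1)] holomorphic_intros) auto
      then show "(\<lambda>w. f1 (w + \<i> * of_real \<tau>) - f2 s0) holomorphic_on cball s0 \<rho>"
        by (intro holomorphic_intros) (simp add: o_def)
      show "cmod (f1 (s0 + \<i> * of_real \<tau>) - f2 s0) < d" using \<tau> U(3) by simp
      fix w assume w: "w \<in> sphere s0 \<rho>"
      then have "w \<in> ?U" using sub by auto
      then have "cmod (f1 (w + \<i> * of_real \<tau>) - f2 w) < d" using \<tau> by simp
      moreover have "2 * d \<le> cmod (f2 w - f2 s0)" using z(2)[OF w] by (simp add: d_def)
      moreover have "cmod (f2 w - f2 s0) \<le> cmod (f1 (w + \<i> * of_real \<tau>) - f2 s0) + cmod (f1 (w + \<i> * of_real \<tau>) - f2 w)"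
        using norm_triangle_ineq4[of "f1 (w + \<i> * of_real \<tau>) - f2 s0" "f1 (w + \<i> * of_real \<tau>) - f2 w"] by simp
      ultimately show "d \<le> cmod (f1 (w + \<i> * of_real \<tau>) - f2 s0)" by linarith
    qed
    then obtain w where "w \<in> cball s0 \<rho>" and w: "f1 (w + \<i> * of_real \<tau>) = f2 s0" by auto
    with sub have "w \<in> ?U" by blast
    then have "Re (w + \<i> * of_real \<tau>) \<in> E" by (auto intro: abE)
    with w show ?thesis by blast
  qed
qed

section \<open>Equality of the value sets\<close>

lemma UN_Img: "(\<Union>\<sigma>\<in>E. Img f \<sigma>) = f ` {s. Re s \<in> E}"
proof
  show "(\<Union>\<sigma>\<in>E. Img f \<sigma>) \<subseteq> f ` {s. Re s \<in> E}" by (auto simp: Img_def)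
  show "f ` {s. Re s \<in> E} \<subseteq> (\<Union>\<sigma>\<in>E. Img f \<sigma>)"
    by (auto simp: Img_def) (metis complex_surj)
qed

theorem theorem1:
  fixes \<Lambda> :: "real set" and lam :: "nat \<Rightarrow> real"
    and \<alpha> \<beta> :: ereal and f1 f2 :: "complex \<Rightarrow> complex" and E :: "real set"
  assumes "countable \<Lambda>" and "enumerates lam \<Lambda>"
    and "\<alpha> < \<beta>"
    and "f1 \<in> D_class \<alpha> \<beta> \<Lambda>" and "f2 \<in> D_class \<alpha> \<beta> \<Lambda>"
    and "star_equiv \<alpha> \<beta> \<Lambda> lam f1 f2"
    and "open E" and "\<forall>\<sigma>\<in>E. \<alpha> < ereal \<sigma> \<and> ereal \<sigma> < \<beta>"
  shows "(\<Union>\<sigma>\<in>E. Img f1 \<sigma>) = (\<Union>\<sigma>\<in>E. Img f2 \<sigma>)"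
  unfolding UN_Img
proof
  show "f1 ` {s. Re s \<in> E} \<subseteq> f2 ` {s. Re s \<in> E}"
    using star_equiv_image_subset[OF assms(2,5,4) star_equiv_sym[OF assms(6)] assms(7,8)]
    by (auto simp: image_iff) metis
  show "f2 ` {s. Re s \<in> E} \<subseteq> f1 ` {s. Re s \<in> E}"
    using star_equiv_image_subset[OF assms(2,4,5,6,7,8)]
    by (auto simp: image_iff) metis
qed

end
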